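(* Let $n,k$ be positive integers, let $\chi$ be a riwi-map on $\mathcal{F}'_{n,k}$, let $q=n/\gcd(n,k)$, and for each neck-class of $\mathcal{F}'_{n,k,0}$ fix an arbitrary representative $f$. Define $\sigma_\chi:\mathcal{F}'_{n,k,0}\to\mathcal{N}'_{n,k}$ by $\sigma_\chi(c^{iq}(f))=\nu(\chi^i(f))$ for each chosen representative $f$ and each $0\le i<n/q$. Then $\sigma_\chi$ is a bijection between $\mathcal{F}'_{n,k,0}$ and $\mathcal{N}'_{n,k}$.
   Context: An $(n,k)$-code is a function $f:\mathbb{Z}_n\to\mathbb{Z}_{\ge 0}$ (positions indexed cyclically, written $f=(f_0,\dots,f_{n-1})$) with $\sum_i f_i=k$. For $t\in\mathbb{Z}_n$, $\mathcal{F}_{n,k,t}$ is the set of $(n,k)$-codes with $\sum_i i f_i\equiv t\pmod n$. The rotation map is $c(f_0,\dots,f_{n-1})=(f_1,\dots,f_{n-1},f_0)$. The period of a code $f$ is the least $p\ge1$ with $c^p(f)=f$. $\mathcal{F}'_{n,k,t}$ is the set of codes in $\mathcal{F}_{n,k,t}$ of period $n$, and $\mathcal{F}'_{n,k}=\bigcup_t\mathcal{F}'_{n,k,t}$. $\mathcal{N}_{n,k}$ is the set of binary necklaces (cyclic words up to rotation) of length $n+k$ with $n$ black beads and $k$ white beads. To a code $f$ associate the necklace $\nu(f)$ given by the cyclic word $B W^{f_0} B W^{f_1}\cdots B W^{f_{n-1}}$ (so $f_i$ counts the white beads between the $i$-th and $(i+1)$-st black bead); $\nu(f)=\nu(g)$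 iff $g=c^j(f)$ for some $j$, and every necklace is $\nu(f)$ for some code $f$. $\mathcal{N}'_{n,k}$ is the set of necklaces $\nu(f)$ with $f$ of period $n$. With $q=n/\gcd(n,k)$, for $f\in\mathcal{F}_{n,k,t}$ the neck-class of $f$ is $\{f,c^q(f),c^{2q}(f),\dots,c^{n-q}(f)\}$ (these are exactly the codes in $\mathcal{F}_{n,k,t}$ rotation-equivalent to $f$). A riwi-map is a map $\chi:\mathcal{F}'_{n,k}\to\mathcal{F}'_{n,k}$ that is bijective, satisfies $c\chi=\chi c$, and maps $\mathcal{F}'_{n,k,t}$ into $\mathcal{F}'_{n,k,t+1}$ for every $t\in\mathbb{Z}_n$. *)

theory Defs
  imports "HOL-Number_Theory.Cong"
begin

text \<open>A code \<open>(f\<^sub>0, \<dots>, f\<^sub>n\<^sub>-\<^sub>1)\<close> is the list of its values. With this convention the rotation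
  map \<open>c\<close> is \<^const>\<open>rotate1\<close>, and \<open>c\<^sup>j\<close> is \<^term>\<open>rotate j\<close>.\<close>

definition codes :: "nat \<Rightarrow> nat \<Rightarrow> nat list set" where
  "codes n k = {f. length f = n \<and> sum_list f = k}"

text \<open>Residues \<open>t \<in> \<int>\<^sub>n\<close> are given by arbitrary natural number representatives.\<close>

definition codes_at :: "nat \<Rightarrow> nat \<Rightarrow> nat \<Rightarrow> nat list set" where
  "codes_at n k t = {f \<in> codes n k. [(\<Sum>i<n. i * f ! i) = t] (mod n)}"

definition period :: "nat list \<Rightarrow> nat" where
  "period f = (LEAST p. p \<ge> 1 \<and> rotate p f = f)"

definition aper_codes_at :: "nat \<Rightarrow> nat \<Rightarrow> nat \<Rightarrow> nat list set" where
  "aper_codes_at n k t = {f \<in> codes_at n k t. period f = n}"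

definition aper_codes :: "nat \<Rightarrow> nat \<Rightarrow> nat list set" where
  "aper_codes n k = (\<Union>t<n. aper_codes_at n k t)"

datatype bead = Black | White

definition rotation_rel :: "(bead list \<times> bead list) set" where
  "rotation_rel = {(u, v). \<exists>j. v = rotate j u}"

definition necklaces :: "nat \<Rightarrow> nat \<Rightarrow> bead list set set" where
  "necklaces n k =
     {w. length w = n + k \<and> count_list w Black = n \<and> count_list w White = k} // rotation_rel"

definition code_word :: "nat list \<Rightarrow> bead list" where
  "code_word f = concat (map (\<lambda>a. Black # replicate a White) f)"

definition necklace_of :: "nat list \<Rightarrow> bead list set" where
  "necklace_of f = rotation_rel `` {code_word f}"

definition aper_necklaces :: "nat \<Rightarrow> nat \<Rightarrow> bead list set set" where
  "aper_necklaces n k = {N \<in> necklaces n k. \<exists>f \<in> aper_codes n k. N = necklace_of f}"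

definition step :: "nat \<Rightarrow> nat \<Rightarrow> nat" where
  "step n k = n div gcd n k"

definition neck_class :: "nat \<Rightarrow> nat \<Rightarrow> nat list \<Rightarrow> nat list set" where
  "neck_class n k f = {rotate (i * step n k) f | i. i < n div step n k}"

definition aper_neck_classes :: "nat \<Rightarrow> nat \<Rightarrow> nat \<Rightarrow> nat list set set" where
  "aper_neck_classes n k t = neck_class n k ` aper_codes_at n k t"

definition riwi_map :: "nat \<Rightarrow> nat \<Rightarrow> (nat list \<Rightarrow> nat list) \<Rightarrow> bool" where
  "riwi_map n k \<chi> \<longleftrightarrow>
     bij_betw \<chi> (aper_codes n k) (aper_codes n k) \<and>
     (\<forall>f \<in> aper_codes n k. rotate1 (\<chi> f) = \<chi> (rotate1 f)) \<and>
     (\<forall>t<n. \<chi> ` aper_codes_at n k t \<subseteq> aper_codes_at n k (t + 1))"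

text \<open>The defining equations of \<open>\<sigma>\<^sub>\<chi>\<close>, where \<open>rep C\<close> is the chosen representative of the
  neck-class \<open>C\<close>. They constrain \<open>\<sigma>\<close> on \<^term>\<open>aper_codes_at n k 0\<close> only.\<close>

definition is_sigma :: "nat \<Rightarrow> nat \<Rightarrow> (nat list \<Rightarrow> nat list) \<Rightarrow> (nat list set \<Rightarrow> nat list) \<Rightarrow>
    (nat list \<Rightarrow> bead list set) \<Rightarrow> bool" where
  "is_sigma n k \<chi> rep \<sigma> \<longleftrightarrow>
     (\<forall>C \<in> aper_neck_classes n k 0. \<forall>i < n div step n k.
        \<sigma> (rotate (i * step n k) (rep C)) = necklace_of ((\<chi> ^^ i) (rep C)))"

end

theory Submission
  imports Defs
begin

text \<open>Rotating a code lowers its weight \<open>\<Sum>i. i * f\<^sub>i\<close> by \<open>k\<close> modulo \<open>n\<close>, so the weights met along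
  a rotation orbit form a residue class modulo \<open>gcd n k\<close>, while \<open>\<chi>\<close> raises the weight by one. As
  necklaces are rotation orbits, \<open>\<nu>(\<chi>\<^sup>i(f))\<close> determines \<open>i\<close> modulo \<open>gcd n k\<close>; since \<open>\<chi>\<close> is
  injective and commutes with rotation, it then also determines the neck-class of \<open>f\<close>.
  Conversely, every orbit contains a code of some weight \<open>i < gcd n k\<close>, and pulling this code back
  along \<open>\<chi>\<^sup>i\<close> yields one of weight \<open>0\<close>.\<close>

section \<open>Code words and rotations\<close>

lemma code_word_Nil [simp]: "code_word [] = []"
  by (simp add: code_word_def)

lemma code_word_Cons [simp]: "code_word (a # f) = Black # replicate a White @ code_word f"
  by (simp add: code_word_def)

lemma code_word_append: "code_word (f @ g) = code_word f @ code_word g"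
  by (simp add: code_word_def)

lemma code_word_eq_Nil_iff [simp]: "code_word f = [] \<longleftrightarrow> f = []"
  by (cases f) auto

lemma hd_code_word: "f \<noteq> [] \<Longrightarrow> hd (code_word f) = Black"
  by (cases f) auto

lemma length_code_word: "length (code_word f) = length f + sum_list f"
  by (induction f) auto

lemma count_list_replicate: "count_list (replicate m x) y = (if x = y then m else 0)"
  by (induction m) auto

lemma count_code_word_Black: "count_list (code_word f) Black = length f"
  by (induction f) (auto simp: count_list_replicate)

lemma count_code_word_White: "count_list (code_word f) White = sum_list f"
  by (induction f) (auto simp: count_list_replicate)

text \<open>A nonempty code word opens with a Black bead, so the run of White beads stops exactly
  there; this lets the first entry of a code be read off its word.\<close>

lemma takeWhile_White_code_word:
  "takeWhile ((=) White) (replicate a White @ code_word f) = replicate a White"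
  by (induction a; cases f) auto

lemma inj_code_word: "inj code_word"
proof (rule injI)
  fix f g assume "code_word f = code_word g"
  then show "f = g"
  proof (induction f arbitrary: g)
    case Nil
    then show ?case by (metis code_word_eq_Nil_iff)
  next
    case (Cons a f)
    then obtain b g' where g: "g = b # g'" by (cases g) auto
    have eq: "replicate a White @ code_word f = replicate b White @ code_word g'"
      using Cons.prems g by simp
    then have "replicate a White = replicate b White"
      by (metis takeWhile_White_code_word)
    then have "a = b" by (metis length_replicate)
    then show ?case using eq Cons.IH g by simp
  qed
qed

text \<open>Black beads occur only at the start of a block, so a cut in front of one falls between
  two blocks and splits the code itself.\<close>

lemma code_word_splitE:
  assumes "code_word f = x @ y" "y \<noteq> []" "hd y = Black"
  obtains f1 f2 where "f = f1 @ f2" "x = code_word f1" "y = code_word f2"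
  using assms(1)
proof (induction f arbitrary: x thesis)
  case Nil
  then show ?case using assms by auto
next
  case (Cons a f)
  show ?case
  proof (cases x)
    case Nil
    then show ?thesis using Cons.prems(1)[of "[]" "a # f"] Cons.prems(2) by simp
  next
    case (Cons c x')
    then have c: "c = Black" and eq: "replicate a White @ code_word f = x' @ y"
      using Cons.prems by auto
    from eq consider us where "x' = replicate a White @ us" "code_word f = us @ y"
      | us where "replicate a White = x' @ us" "us @ code_word f = y"
      by (auto simp: append_eq_append_conv2)
    then show ?thesis
    proof cases
      case 1
      obtain f1 f2 where "f = f1 @ f2" "us = code_word f1" "y = code_word f2"
        using Cons.IH 1(2) by blast
      then show ?thesis using Cons.prems(1)[of "a # f1" f2] 1 c Cons by simp
    next
      case 2
      \<comment> \<open>A nonempty \<open>us\<close> would put a White bead at the head of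
        \<open>y\<close>.\<close>
      have "us = []"
      proof (rule ccontr)
        assume "us \<noteq> []"
        then have "hd us \<in> set (replicate a White)" "hd us = hd y"
          using 2 by auto
        then show False using assms by auto
      qed
      then show ?thesis using Cons.prems(1)[of "[a]" f] 2 c Cons by simp
    qed
  qed
qed

lemma rotate_append_eq: "\<exists>j. rotate j (x @ y) = y @ x"
  by (metis rotate_append)

lemma rotate_eq_append: "\<exists>x y. w = x @ y \<and> rotate j w = y @ x"
  by (metis append_take_drop_id rotate_drop_take)

lemma rotate_inverse: "\<exists>m'. rotate m' (rotate m f) = f"
proof
  \<comment> \<open>The truncated subtraction is harmless: a nonempty list has
    \<open>m \<le> m * length f\<close>, so the two shifts add up to a multiple of the
    length.\<close>
  have "m * length f - m + m = m * length f" if "f \<noteq> []"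
    using that by (cases f) auto
  then show "rotate (m * length f - m) (rotate m f) = f"
    by (cases "f = []") (auto simp: rotate_rotate)
qed

lemma inj_rotate: "inj (rotate m :: 'a list \<Rightarrow> 'a list)"
proof (rule injI)
  fix f g :: "'a list" assume eq: "rotate m f = rotate m g"
  then have len: "length f = length g" by (metis length_rotate)
  have "rotate (m * length f - m + m) f = rotate (m * length f - m + m) g"
    using eq by (metis rotate_rotate)
  then show "f = g"
    using len by (cases "length f = 0") auto
qed

text \<open>Moving whole entries moves whole blocks of beads; the bead shift depends on the entries,
  so only its existence is stated.\<close>

lemma code_word_rotate: "\<exists>j. code_word (rotate m f) = rotate j (code_word f)"
proof -
  obtain x y where "f = x @ y" "rotate m f = y @ x"
    using rotate_eq_append by blast
  then show ?thesis
    using rotate_append_eq[of "code_word x" "code_word y"] by (metis code_word_append)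
qed

text \<open>Unless the cut is trivial, \<open>code_word g\<close> begins with the second part of
  \<open>code_word f\<close>. That part therefore starts with a Black bead, and the cut falls
  between blocks.\<close>

lemma code_word_eq_rotateD:
  assumes "code_word g = rotate j (code_word f)"
  shows "\<exists>m. g = rotate m f"
proof -
  obtain x y where xy: "code_word f = x @ y" "rotate j (code_word f) = y @ x"
    using rotate_eq_append by blast
  show ?thesis
  proof (cases "y = []")
    case True
    then have "code_word g = code_word f" using xy assms by simp
    then have "g = rotate 0 f" using injD[OF inj_code_word] by auto
    then show ?thesis ..
  next
    case False
    then have "g \<noteq> []" using xy assms by auto
    then have "hd y = Black" using False xy assms hd_code_word[of g] by simp
    then obtain f1 f2 where f: "f = f1 @ f2" "x = code_word f1" "y = code_word f2"
      using code_word_splitE xy(1) False by metis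
    then have "code_word g = code_word (f2 @ f1)"
      using xy assms by (simp add: code_word_append)
    then have "g = f2 @ f1" by (rule injD[OF inj_code_word])
    then show ?thesis using f rotate_append_eq by metis
  qed
qed

section \<open>Necklaces as rotation classes of code words\<close>

lemma equiv_rotation_rel: "equiv UNIV rotation_rel"
proof (rule equivI)
  show "refl rotation_rel"
    by (auto simp: refl_on_def rotation_rel_def intro: exI[of _ 0])
  show "sym rotation_rel"
    by (auto simp: sym_def rotation_rel_def) (metis rotate_inverse)
  show "trans rotation_rel"
    by (auto simp: trans_def rotation_rel_def rotate_rotate)
qed simp

lemma necklace_of_eq_iff: "necklace_of f = necklace_of g \<longleftrightarrow> (\<exists>m. g = rotate m f)"
proof -
  have "necklace_of f = necklace_of g \<longleftrightarrow> (code_word f, code_word g) \<in> rotation_rel"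
    unfolding necklace_of_def using eq_equiv_class_iff[OF equiv_rotation_rel] by simp
  also have "\<dots> \<longleftrightarrow> (\<exists>j. code_word g = rotate j (code_word f))"
    by (simp add: rotation_rel_def)
  also have "\<dots> \<longleftrightarrow> (\<exists>m. g = rotate m f)"
    using code_word_eq_rotateD code_word_rotate by metis
  finally show ?thesis .
qed

lemma necklace_of_in_necklaces: "f \<in> codes n k \<Longrightarrow> necklace_of f \<in> necklaces n k"
  unfolding necklaces_def necklace_of_def codes_def
  by (intro quotientI)
    (auto simp: length_code_word count_code_word_Black count_code_word_White)

section \<open>Weights and periods\<close>

text \<open>The sum from \<open>codes_at\<close>, bounded by \<open>length f\<close> so that it
  makes sense for lists of any length and can be computed along Cons and snoc.\<close>

definition weight :: "nat list \<Rightarrow> nat" where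
  "weight f = (\<Sum>i<length f. i * f ! i)"

lemma weight_Cons: "weight (x # xs) = weight xs + sum_list xs"
proof -
  have "weight (x # xs) = (\<Sum>i<length xs. Suc i * xs ! i)"
    unfolding weight_def by (simp add: sum.lessThan_Suc_shift del: sum.lessThan_Suc)
  also have "\<dots> = weight xs + (\<Sum>i<length xs. xs ! i)"
    unfolding weight_def by (simp add: sum.distrib)
  finally show ?thesis by (simp add: sum_list_sum_nth atLeast0LessThan)
qed

lemma weight_snoc: "weight (xs @ [x]) = weight xs + length xs * x"
  unfolding weight_def by (simp add: nth_append)

text \<open>The head moves from position 0 to the last one and every other entry drops by one
  position; up to a multiple of the length this costs one copy of each entry. The sum stands on the
  left to avoid subtraction of naturals.\<close>

lemma weight_rotate1: "[weight (rotate1 f) + sum_list f = weight f] (mod length f)"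
proof (cases f)
  case (Cons x xs)
  then have "weight (rotate1 f) + sum_list f = weight f + x * length f"
    by (simp add: weight_Cons weight_snoc algebra_simps)
  then show ?thesis by (simp add: cong_def)
qed simp

lemma sum_list_rotate [simp]: "sum_list (rotate m (f :: nat list)) = sum_list f"
proof (induction m)
  case (Suc m)
  have "sum_list (rotate1 g) = sum_list g" for g :: "nat list"
    by (cases g) auto
  then show ?case using Suc by simp
qed simp

lemma weight_rotate: "[weight (rotate m f) + m * sum_list f = weight f] (mod length f)"
proof (induction m)
  case (Suc m)
  have "[weight (rotate (Suc m) f) + sum_list f = weight (rotate m f)] (mod length f)"
    using weight_rotate1[of "rotate m f"] by simp
  then have "[weight (rotate (Suc m) f) + sum_list f + m * sum_list f
      = weight (rotate m f) + m * sum_list f] (mod length f)"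
    by (intro cong_add) auto
  from cong_trans[OF this Suc] show ?case
    by (simp add: algebra_simps)
qed simp

text \<open>Rotations commute and are injective, so a code and its rotations are fixed by the same
  shifts.\<close>

lemma period_rotate [simp]: "period (rotate m f) = period f"
proof -
  have "rotate p (rotate m f) = rotate m f \<longleftrightarrow> rotate p f = f" for p
    by (metis inj_rotate injD rotate_rotate add.commute)
  then show ?thesis unfolding period_def by simp
qed

lemma period_le: "p \<ge> 1 \<Longrightarrow> rotate p f = f \<Longrightarrow> period f \<le> p"
  unfolding period_def by (rule Least_le) simp

lemma in_aper_codes_at_iff:
  "f \<in> aper_codes_at n k t \<longleftrightarrow>
     length f = n \<and> sum_list f = k \<and> period f = n \<and> [weight f = t] (mod n)"
  unfolding aper_codes_at_def codes_at_def codes_def weight_def by auto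

lemma in_aper_codes_iff:
  assumes "n > 0"
  shows "f \<in> aper_codes n k \<longleftrightarrow> length f = n \<and> sum_list f = k \<and> period f = n"
proof -
  have "\<exists>t<n. [weight f = t] (mod n)"
    by (rule exI[of _ "weight f mod n"]) (use assms in \<open>simp add: cong_def\<close>)
  then show ?thesis
    unfolding aper_codes_def by (auto simp: in_aper_codes_at_iff)
qed

lemma rotate_in_aper_codes_iff:
  "n > 0 \<Longrightarrow> rotate m f \<in> aper_codes n k \<longleftrightarrow> f \<in> aper_codes n k"
  by (simp add: in_aper_codes_iff)

lemma necklace_of_in_aper_necklaces:
  "n > 0 \<Longrightarrow> f \<in> aper_codes n k \<Longrightarrow> necklace_of f \<in> aper_necklaces n k"
  unfolding aper_necklaces_def
  by (auto simp: in_aper_codes_iff codes_def intro!: necklace_of_in_necklaces)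

section \<open>Neck-classes\<close>

lemma step_mult_gcd: "step n k * gcd n k = n"
  unfolding step_def by simp

lemma step_pos: "n > 0 \<Longrightarrow> step n k > 0"
  by (metis step_mult_gcd mult_is_0 neq0_conv)

lemma div_step: "n > 0 \<Longrightarrow> n div step n k = gcd n k"
  by (metis step_mult_gcd step_pos nonzero_mult_div_cancel_left neq0_conv)

text \<open>Cancelling \<open>gcd n k\<close> leaves the coprime numbers \<open>step n k\<close> and
  \<open>k div gcd n k\<close>. As rotation by \<open>m\<close> shifts the weight by
  \<open>m * k\<close>, this singles out the rotations that preserve it modulo
  \<open>n\<close>.\<close>

lemma dvd_mult_iff_step_dvd:
  assumes "n > 0"
  shows "n dvd m * k \<longleftrightarrow> step n k dvd m"
proof -
  define d where "d = gcd n k"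
  have d: "d > 0" using assms by (simp add: d_def)
  have k: "k = k div d * d" by (simp add: d_def)
  have "n dvd m * k \<longleftrightarrow> step n k * d dvd m * (k div d) * d"
    using step_mult_gcd[of n k] k by (simp add: d_def mult.assoc)
  also have "\<dots> \<longleftrightarrow> step n k dvd m * (k div d)" using d by simp
  also have "\<dots> \<longleftrightarrow> step n k dvd m"
    using div_gcd_coprime[of n k] assms
    by (simp add: step_def d_def coprime_dvd_mult_left_iff)
  finally show ?thesis .
qed

lemma rotate_in_aper_codes_at_iff:
  assumes "f \<in> aper_codes_at n k s"
  shows "rotate m f \<in> aper_codes_at n k t \<longleftrightarrow> [t + m * k = s] (mod n)"
proof -
  have f: "length f = n" "sum_list f = k" "period f = n" "[weight f = s] (mod n)"
    using assms by (auto simp: in_aper_codes_at_iff)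
  have "[weight (rotate m f) + m * k = s] (mod n)"
    using weight_rotate[of m f] f cong_trans by blast
  then have "[weight (rotate m f) = t] (mod n) \<longleftrightarrow> [t + m * k = s] (mod n)"
    by (metis cong_add_rcancel_nat cong_sym cong_trans)
  then show ?thesis using f by (simp add: in_aper_codes_at_iff)
qed

text \<open>Weight 0 modulo \<open>n\<close> survives exactly the shifts divisible by
  \<open>step n k\<close>, and shifts count modulo \<open>n\<close>. Neck-classes thus become traces
  of rotation orbits on the codes of weight 0.\<close>

lemma neck_class_eq:
  assumes "n > 0" "f \<in> aper_codes_at n k 0"
  shows "neck_class n k f = {g \<in> aper_codes_at n k 0. \<exists>m. g = rotate m f}"
proof -
  have len: "length f = n" using assms by (simp add: in_aper_codes_at_iff)
  have iff: "rotate m f \<in> aper_codes_at n k 0 \<longleftrightarrow> step n k dvd m" for m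
    using rotate_in_aper_codes_at_iff[OF assms(2), of m 0] dvd_mult_iff_step_dvd[OF assms(1)]
    by (simp add: cong_0_iff)
  show ?thesis
  proof (intro equalityI subsetI)
    fix g assume "g \<in> neck_class n k f"
    then obtain i where g: "g = rotate (i * step n k) f" unfolding neck_class_def by blast
    moreover have "g \<in> aper_codes_at n k 0" unfolding g iff by simp
    ultimately show "g \<in> {g \<in> aper_codes_at n k 0. \<exists>m. g = rotate m f}" by blast
  next
    fix g assume "g \<in> {g \<in> aper_codes_at n k 0. \<exists>m. g = rotate m f}"
    then obtain m where m: "g = rotate m f" "step n k dvd m" using iff by auto
    then obtain r where r: "m = step n k * r" by blast
    \<comment> \<open>With \<open>n = step n k * gcd n k\<close>, reducing the shift modulo
      \<open>n\<close> reduces its multiplier \<open>r\<close> modulo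
      \<open>gcd n k\<close>.\<close>
    have "m mod n = (step n k * r) mod (step n k * gcd n k)"
      by (simp only: r step_mult_gcd)
    also have "\<dots> = (r mod gcd n k) * step n k"
      by (simp only: mult_mod_right mult.commute)
    finally have "g = rotate ((r mod gcd n k) * step n k) f"
      using m len rotate_conv_mod[of m f] by simp
    moreover have "r mod gcd n k < n div step n k"
      using assms by (simp add: div_step)
    ultimately show "g \<in> neck_class n k f" unfolding neck_class_def by blast
  qed
qed

lemma neck_class_eqI:
  assumes "n > 0" "f \<in> aper_codes_at n k 0" "g \<in> neck_class n k f"
  shows "neck_class n k g = neck_class n k f"
proof -
  obtain m where m: "g = rotate m f" and g: "g \<in> aper_codes_at n k 0"
    using assms by (auto simp: neck_class_eq)
  obtain m' where m': "f = rotate m' g"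
    using rotate_inverse[of m f] m by metis
  have "(\<exists>j. h = rotate j g) \<longleftrightarrow> (\<exists>j. h = rotate j f)" for h
    using m m' by (metis rotate_rotate)
  then show ?thesis using assms g by (simp add: neck_class_eq)
qed

lemma self_in_neck_class: "n > 0 \<Longrightarrow> f \<in> aper_codes_at n k 0 \<Longrightarrow> f \<in> neck_class n k f"
  by (auto simp: neck_class_eq intro: exI[of _ 0])

text \<open>Two distinct indices would yield a shift \<open>p\<close> that fixes \<open>f\<close>
  and is positive but below \<open>gcd n k * step n k = n\<close>, against period
  \<open>n\<close>.\<close>

lemma rotate_step_inj:
  assumes "n > 0" "f \<in> aper_codes_at n k t" "i < gcd n k" "j < gcd n k"
    and eq: "rotate (i * step n k) f = rotate (j * step n k) f"
  shows "i = j"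
proof -
  \<comment> \<open>Stated for an ordered pair, so that it excludes both \<open>i < j\<close> and
    \<open>j < i\<close>.\<close>
  have "\<not> a < b" if "b < gcd n k" "rotate (a * step n k) f = rotate (b * step n k) f" for a b
  proof
    assume "a < b"
    define p where "p = (b - a) * step n k"
    have "b * step n k = a * step n k + p"
      using \<open>a < b\<close> by (simp add: p_def diff_mult_distrib)
    then have "rotate (a * step n k) (rotate p f) = rotate (a * step n k) f"
      using that by (simp add: rotate_rotate)
    then have "rotate p f = f" by (rule injD[OF inj_rotate])
    moreover have "p \<ge> 1" using \<open>a < b\<close> step_pos[OF assms(1), of k] by (simp add: p_def)
    ultimately have "n \<le> p"
      using period_le assms(2) by (metis in_aper_codes_at_iff)
    moreover have "p < gcd n k * step n k"
      unfolding p_def using that step_pos[OF assms(1), of k] by (intro mult_strict_right_mono) auto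
    ultimately show False using step_mult_gcd[of n k] by (simp add: mult.commute)
  qed
  from this[OF assms(3) eq[symmetric]] this[OF assms(4) eq] show ?thesis by linarith
qed

section \<open>The bijection\<close>

lemma aper_codes_at_mod: "aper_codes_at n k (t mod n) = aper_codes_at n k t"
  by (auto simp: in_aper_codes_at_iff cong_def)

lemma aper_codes_at_subset: "n > 0 \<Longrightarrow> aper_codes_at n k t \<subseteq> aper_codes n k"
  by (auto simp: in_aper_codes_at_iff in_aper_codes_iff)

section \<open>Iterates of a riwi-map\<close>

context
  fixes n k :: nat and \<chi> :: "nat list \<Rightarrow> nat list"
  assumes n_pos: "n > 0" and riwi: "riwi_map n k \<chi>"
begin

lemma riwi_pow_bij: "bij_betw (\<chi> ^^ i) (aper_codes n k) (aper_codes n k)"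
  using riwi unfolding riwi_map_def by (simp add: bij_betw_funpow)

lemma riwi_pow_rotate:
  assumes "f \<in> aper_codes n k"
  shows "(\<chi> ^^ i) (rotate m f) = rotate m ((\<chi> ^^ i) f)"
proof -
  have 1: "\<chi> (rotate m g) = rotate m (\<chi> g)" if "g \<in> aper_codes n k" for g
  proof (induction m)
    case (Suc m)
    have "\<chi> (rotate1 (rotate m g)) = rotate1 (\<chi> (rotate m g))"
      using riwi that unfolding riwi_map_def by (simp add: rotate_in_aper_codes_iff n_pos)
    then show ?case using Suc by simp
  qed simp
  \<comment> \<open>The iterates stay among the aperiodic codes, where commutation with rotation is
    available.\<close>
  have mem: "(\<chi> ^^ i) f \<in> aper_codes n k" for i
    using riwi_pow_bij assms by (auto simp: bij_betw_def)
  show ?thesis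
    by (induction i) (simp_all add: 1 mem)
qed

lemma riwi_pow_aper_codes_at:
  assumes "f \<in> aper_codes_at n k t"
  shows "(\<chi> ^^ i) f \<in> aper_codes_at n k (t + i)"
proof (induction i)
  case (Suc i)
  \<comment> \<open>The riwi condition speaks of residues \<open>t < n\<close>, so the index is
    reduced before \<open>\<chi>\<close> is applied once more.\<close>
  have "(\<chi> ^^ i) f \<in> aper_codes_at n k ((t + i) mod n)"
    using Suc by (simp add: aper_codes_at_mod)
  then have "\<chi> ((\<chi> ^^ i) f) \<in> aper_codes_at n k ((t + i) mod n + 1)"
    using riwi n_pos unfolding riwi_map_def by (meson image_subset_iff mod_less_divisor)
  then have "\<chi> ((\<chi> ^^ i) f) \<in> aper_codes_at n k (((t + i) mod n + 1) mod n)"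
    by (simp only: aper_codes_at_mod)
  then show ?case
    by (simp add: mod_simps aper_codes_at_mod)
qed (use assms in simp)

lemma riwi_necklace_eqD:
  assumes fg: "f \<in> aper_codes_at n k 0" "g \<in> aper_codes_at n k 0"
    and ij: "i < gcd n k" "j < gcd n k"
    and eq: "necklace_of ((\<chi> ^^ i) f) = necklace_of ((\<chi> ^^ j) g)"
  shows "i = j \<and> g \<in> neck_class n k f"
proof -
  obtain m where m: "(\<chi> ^^ j) g = rotate m ((\<chi> ^^ i) f)"
    using eq by (auto simp: necklace_of_eq_iff)
  have f: "(\<chi> ^^ i) f \<in> aper_codes_at n k i" and g: "(\<chi> ^^ j) g \<in> aper_codes_at n k j"
    using fg riwi_pow_aper_codes_at by fastforce+
  have "[j + m * k = i] (mod n)"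
    using rotate_in_aper_codes_at_iff[OF f, of m j] g m by simp
  \<comment> \<open>Modulo \<open>gcd n k\<close>, a divisor of both \<open>n\<close> and
    \<open>k\<close>, the unknown shift \<open>m\<close> disappears.\<close>
  then have "[j + m * k = i] (mod gcd n k)"
    by (rule cong_dvd_modulus_nat) simp
  moreover have "[j + m * k = j + 0] (mod gcd n k)"
    by (intro cong_add) (auto simp: cong_0_iff)
  ultimately have "[i = j] (mod gcd n k)"
    by (metis cong_sym cong_trans add_0_right)
  then have "i = j" using ij by (simp add: cong_def)
  have f': "f \<in> aper_codes n k" and g': "g \<in> aper_codes n k"
    using fg aper_codes_at_subset[OF n_pos] by auto
  \<comment> \<open>As \<open>i = j\<close>, the rotation passes inside \<open>\<chi> ^^ j\<close>,
    which injectivity then strips from both sides.\<close>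
  have "(\<chi> ^^ j) g = (\<chi> ^^ j) (rotate m f)"
    using m \<open>i = j\<close> riwi_pow_rotate[OF f'] by simp
  then have "g = rotate m f"
    using riwi_pow_bij[of j] f' g'
    by (auto simp: bij_betw_def rotate_in_aper_codes_iff n_pos dest: inj_onD)
  then show ?thesis using fg \<open>i = j\<close> by (auto simp: neck_class_eq n_pos)
qed

lemma riwi_necklace_surj:
  assumes k: "k > 0" and N: "N \<in> aper_necklaces n k"
  obtains i f where "i < gcd n k" "f \<in> aper_codes_at n k 0" "N = necklace_of ((\<chi> ^^ i) f)"
proof -
  obtain h where h: "h \<in> aper_codes n k" "N = necklace_of h"
    using N by (auto simp: aper_necklaces_def)
  define t where "t = weight h"
  define d where "d = gcd n k"
  define i where "i = t mod d"
  have hA: "h \<in> aper_codes_at n k t"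
    using h by (simp add: in_aper_codes_iff in_aper_codes_at_iff t_def n_pos)
  have "i < d" using n_pos by (simp add: i_def d_def)
  \<comment> \<open>By Bezout some multiple of \<open>k\<close> is \<open>d\<close> modulo
    \<open>n\<close>. Rotating by \<open>m = x * (t div d)\<close> then takes
    \<open>d * (t div d)\<close> off the weight \<open>t\<close> and leaves the remainder
    \<open>i\<close>.\<close>
  obtain x where x: "[k * x = d] (mod n)"
    using cong_solve_nat[of k n] k by (auto simp: d_def gcd.commute)
  define m where "m = x * (t div d)"
  have "[i + m * k = i + d * (t div d)] (mod n)"
    using cong_scalar_right[OF x, of "t div d"]
    by (intro cong_add) (auto simp: m_def ac_simps)
  then have "[i + m * k = t] (mod n)" by (simp add: i_def)
  then have h': "rotate m h \<in> aper_codes_at n k i"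
    using rotate_in_aper_codes_at_iff[OF hA] by simp
  then obtain f where f: "f \<in> aper_codes n k" "(\<chi> ^^ i) f = rotate m h"
    using riwi_pow_bij[of i] aper_codes_at_subset[OF n_pos] unfolding bij_betw_def
    by (metis imageE subsetD)
  \<comment> \<open>Surjectivity says nothing about the weight of the preimage; its residue
    \<open>s\<close> follows by comparing \<open>s + i\<close>, the weight after \<open>i\<close>
    applications of \<open>\<chi>\<close>, with \<open>i\<close>.\<close>
  then obtain s where s: "f \<in> aper_codes_at n k s" by (auto simp: aper_codes_def)
  have "[s + i = 0 + i] (mod n)"
    using riwi_pow_aper_codes_at[OF s, of i] f h'
    by (auto simp: in_aper_codes_at_iff cong_def)
  then have "[s = 0] (mod n)" by (simp only: cong_add_rcancel_nat)
  then have "f \<in> aper_codes_at n k 0"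
    using s by (metis in_aper_codes_at_iff cong_trans)
  moreover have "N = necklace_of ((\<chi> ^^ i) f)"
    using f h by (auto simp: necklace_of_eq_iff)
  ultimately show ?thesis using that \<open>i < d\<close> by (simp add: d_def)
qed

end

section \<open>Bijectivity of \<open>\<sigma>\<close> through pairs of a neck-class and an
  index\<close>

theorem theorem3p1:
  fixes n k :: nat
    and \<chi> :: "nat list \<Rightarrow> nat list"
    and rep :: "nat list set \<Rightarrow> nat list"
  assumes "n > 0" and "k > 0"
    and "riwi_map n k \<chi>"
    and "\<forall>C \<in> aper_neck_classes n k 0. rep C \<in> C"
  shows "(\<exists>\<sigma>. is_sigma n k \<chi> rep \<sigma>) \<and>
         (\<forall>\<sigma>. is_sigma n k \<chi> rep \<sigma> \<longrightarrow>
            bij_betw \<sigma> (aper_codes_at n k 0) (aper_necklaces n k))"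
proof -
  define d where "d = gcd n k"
  let ?A = "aper_codes_at n k 0" and ?Cs = "aper_neck_classes n k 0"
  let ?P = "?Cs \<times> {..<d}"
  \<comment> \<open>\<open>\<phi>\<close> enumerates the codes and \<open>\<psi>\<close> the
    prescribed necklaces; the defining equations say that \<open>\<sigma> \<circ> \<phi>\<close>
    agrees with \<open>\<psi>\<close> on \<open>?P\<close>. Injectivity of \<open>\<phi>\<close>
    makes them consistent, and bijectivity of both maps carries over to
    \<open>\<sigma>\<close>.\<close>
  define \<phi> where "\<phi> = (\<lambda>(C, i). rotate (i * step n k) (rep C))"
  define \<psi> where "\<psi> = (\<lambda>(C, i). necklace_of ((\<chi> ^^ i) (rep C)))"
  have sigma_iff: "is_sigma n k \<chi> rep \<sigma> \<longleftrightarrow> (\<forall>p \<in> ?P. \<sigma> (\<phi> p) = \<psi> p)" for \<sigma>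
    unfolding is_sigma_def \<phi>_def \<psi>_def by (auto simp: d_def div_step assms(1))
  have rep: "rep C \<in> ?A" "neck_class n k (rep C) = C" if C: "C \<in> ?Cs" for C
  proof -
    obtain f where f: "f \<in> ?A" "C = neck_class n k f"
      using C by (auto simp: aper_neck_classes_def)
    have "rep C \<in> neck_class n k f" using assms(4) C f by blast
    then show "rep C \<in> ?A" "neck_class n k (rep C) = C"
      using f assms(1) by (auto simp: neck_class_eqI) (simp add: neck_class_eq)
  qed
  have phi_in: "\<phi> (C, i) \<in> C" if "C \<in> ?Cs" "i < d" for C i
  proof -
    have "\<phi> (C, i) \<in> neck_class n k (rep C)"
      using that by (auto simp: neck_class_def \<phi>_def d_def div_step assms(1))
    then show ?thesis using rep that by simp
  qed
  \<comment> \<open>Any member determines its class, so distinct neck-classes are disjoint.\<close>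
  have class_eq: "C = neck_class n k g" if "C \<in> ?Cs" "g \<in> C" for C g
    using neck_class_eqI[OF assms(1) rep(1)] rep(2) that by metis
  have phi: "bij_betw \<phi> ?P ?A"
    unfolding bij_betw_def
  proof (intro conjI inj_onI equalityI subsetI)
    fix p p' assume p: "p \<in> ?P" "p' \<in> ?P" "\<phi> p = \<phi> p'"
    obtain C i C' i' where pp: "p = (C, i)" "p' = (C', i')" by fastforce
    have C: "C \<in> ?Cs" "C' \<in> ?Cs" and i: "i < d" "i' < d" using p pp by auto
    have "C = C'" using class_eq C phi_in i p(3) pp by metis
    moreover from this have "i = i'"
      using rotate_step_inj[OF assms(1) rep(1)[OF C(1)]] i p(3) pp
      by (simp add: \<phi>_def d_def)
    ultimately show "p = p'" using pp by simp
  next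
    fix g assume "g \<in> \<phi> ` ?P"
    then obtain C i where C: "C \<in> ?Cs" "i < d" "g = \<phi> (C, i)" by auto
    then have "g \<in> neck_class n k (rep C)" using phi_in rep by simp
    then show "g \<in> ?A" using rep C assms(1) by (simp add: neck_class_eq)
  next
    fix g assume g: "g \<in> ?A"
    define C where "C = neck_class n k g"
    have C: "C \<in> ?Cs" using g by (auto simp: C_def aper_neck_classes_def)
    have "g \<in> neck_class n k (rep C)"
      using rep(2)[OF C] self_in_neck_class[OF assms(1) g] by (simp add: C_def)
    then obtain i where "i < d" "g = \<phi> (C, i)"
      by (auto simp: neck_class_def \<phi>_def d_def div_step assms(1))
    then show "g \<in> \<phi> ` ?P" using C by auto
  qed
  have psi: "bij_betw \<psi> ?P (aper_necklaces n k)"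
    unfolding bij_betw_def
  proof (intro conjI inj_onI equalityI subsetI)
    fix p p' assume p: "p \<in> ?P" "p' \<in> ?P" "\<psi> p = \<psi> p'"
    obtain C i C' i' where pp: "p = (C, i)" "p' = (C', i')" by fastforce
    have C: "C \<in> ?Cs" "C' \<in> ?Cs" and i: "i < d" "i' < d" using p pp by auto
    have "i = i' \<and> rep C' \<in> neck_class n k (rep C)"
      by (rule riwi_necklace_eqD[OF assms(1,3) rep(1)[OF C(1)] rep(1)[OF C(2)]])
        (use i p(3) pp in \<open>simp_all add: \<psi>_def d_def\<close>)
    moreover from this have "C = C'"
      using rep(2) class_eq C by metis
    ultimately show "p = p'" using pp by simp
  next
    fix N assume "N \<in> \<psi> ` ?P"
    then obtain C i where C: "C \<in> ?Cs" "N = necklace_of ((\<chi> ^^ i) (rep C))"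
      by (auto simp: \<psi>_def)
    have "(\<chi> ^^ i) (rep C) \<in> aper_codes n k"
      using riwi_pow_aper_codes_at[OF assms(1,3) rep(1)[OF C(1)]]
        aper_codes_at_subset[OF assms(1)] by blast
    then show "N \<in> aper_necklaces n k"
      using C assms(1) by (simp add: necklace_of_in_aper_necklaces)
  next
    fix N assume "N \<in> aper_necklaces n k"
    then obtain i f where f: "i < d" "f \<in> ?A" "N = necklace_of ((\<chi> ^^ i) f)"
      using riwi_necklace_surj[OF assms(1,3,2)] d_def by metis
    \<comment> \<open>The code \<open>f\<close> may differ from the chosen representative, but
      \<open>rep C\<close> is a rotation of it; since \<open>\<chi> ^^ i\<close> commutes with
      rotations, both give the same necklace.\<close>
    define C where "C = neck_class n k f"
    have C: "C \<in> ?Cs" using f by (auto simp: C_def aper_neck_classes_def)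
    then have "rep C \<in> neck_class n k f" using assms(4) by (auto simp: C_def)
    then obtain m where "rep C = rotate m f"
      using f(2) assms(1) by (auto simp: neck_class_eq)
    moreover have "f \<in> aper_codes n k"
      using f(2) aper_codes_at_subset[OF assms(1)] by blast
    ultimately have "(\<chi> ^^ i) (rep C) = rotate m ((\<chi> ^^ i) f)"
      using riwi_pow_rotate[OF assms(1,3)] by simp
    then have "N = \<psi> (C, i)"
      using f by (auto simp: \<psi>_def necklace_of_eq_iff)
    then show "N \<in> \<psi> ` ?P" using C f by auto
  qed
  show ?thesis
  proof (intro conjI allI impI)
    \<comment> \<open>The witness inverts \<open>\<phi>\<close> on \<open>?P\<close>; off
      \<open>?A\<close> its values are unspecified, which the defining equations permit.\<close>
    have "is_sigma n k \<chi> rep (\<lambda>g. \<psi> (inv_into ?P \<phi> g))"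
      unfolding sigma_iff using phi by (auto simp: bij_betw_def simp del: mem_Sigma_iff)
    then show "\<exists>\<sigma>. is_sigma n k \<chi> rep \<sigma>" by blast
  next
    fix \<sigma> assume "is_sigma n k \<chi> rep \<sigma>"
    then have "(\<sigma> \<circ> \<phi>) p = \<psi> p" if "p \<in> ?P" for p
      unfolding sigma_iff comp_def using that by (rule bspec)
    then have "bij_betw (\<sigma> \<circ> \<phi>) ?P (aper_necklaces n k)"
      by (rule bij_betw_cong[THEN iffD2, OF _ psi])
    then show "bij_betw \<sigma> ?A (aper_necklaces n k)"
      by (rule bij_betw_comp_iff[OF phi, THEN iffD2])
  qed
qed

end
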